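(* Let $G$ be a finite group and $c\subset G$ a conjugacy class such that $(G,c)$ is non-splitting, let $k$ be a field, and let $D$ be any positive integer. Then $$\mathbb U:=\sum_{h\in c}r_h^{D\operatorname{ord}(h)}\in R^V$$ is a homogeneous central element of $R^V$ with finite degree kernel and cokernel. Hence $\mathbb U$ is a homogeneous non-invertible central element of $R^V$ such that the kernel and cokernel of multiplication by $\mathbb U$ on $R^V$ both have finite degree.
   Context: $(G,c)$ is non-splitting if $c$ generates $G$ and for every subgroup $K\subset G$ the intersection $c\cap K$ is either empty or a single conjugacy class of $K$. $\operatorname{ord}(h)$ is the order of $h$ in $G$. Let $V_n$ be the $k$-vector space with basis $c^n$, with the Artin braid group $B_n$ on $n$ strands acting through the standard braid (Hurwitz) action on $n$-tuples, generated by $(h_1,\dots,h_n)\mapsto(h_1,\dots,h_{i-1},h_ih_{i+1}h_i^{-1},h_i,h_{i+2},\dots,h_n)$. Set $R^V:=\bigoplus_{n\ge0}H_0(B_n,V_n)$, i.e. the graded $k$-algebra with basis $\bigsqcup_n c^n/B_n$ and multiplication induced by concatenation of tuples. For $h\in c$, $r_h$ denotes right multiplication by $h$ on $R^V$, identified with the degree $1$ element of $R^V$ given by the class of the $1$-tuple $(h)$. The kernel and cokernel of $\mathbb U$ are those of the map $R^V\to R^V$ given by multiplication by $\mathbb U$. The degree of a graded module $M$ is the supremum of $n$ with $\{M\}_n\neq0$; finite degree means this is not $+\infty$. A homogeneous element is called non-invertible if it has positive degree or is $0$.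
   Formalization: The formal theorem also assumes that for every subgroup K of G meeting c, the number |c∩K| is nonzero in k; without this the claim fails (e.g. G=S_3, c the transpositions, k=F_3, where the kernel is nonzero in every degree ≥2). *)

theory Defs
  imports "HOL-Algebra.Algebra" "HOL-Library.Poly_Mapping" "HOL-Library.Extended_Real"
begin

definition conjugacy_class :: "('a, 'b) monoid_scheme \<Rightarrow> 'a set \<Rightarrow> bool" where
  "conjugacy_class G c \<longleftrightarrow>
     c \<in> orbits G (carrier G) (\<lambda>g. \<lambda>h \<in> carrier G. g \<otimes>\<^bsub>G\<^esub> h \<otimes>\<^bsub>G\<^esub> inv\<^bsub>G\<^esub> g)"

definition non_splitting :: "('a, 'b) monoid_scheme \<Rightarrow> 'a set \<Rightarrow> bool" where
  "non_splitting G c \<longleftrightarrow>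
     generate G c = carrier G \<and>
     (\<forall>K. subgroup K G \<longrightarrow> c \<inter> K = {} \<or> conjugacy_class (G\<lparr>carrier := K\<rparr>) (c \<inter> K))"


subsection \<open>The Hurwitz action\<close>

definition tuples :: "'a set \<Rightarrow> nat \<Rightarrow> 'a list set" where
  "tuples c n = {xs. set xs \<subseteq> c \<and> length xs = n}"

text \<open>Positions are counted from 0, so the generators of the braid group on \<open>n\<close> strands
  are indexed by the \<open>i\<close> with \<open>Suc i < n\<close>.\<close>

definition hurwitz_move ::
    "('a, 'b) monoid_scheme \<Rightarrow> 'a set \<Rightarrow> nat \<Rightarrow> nat \<Rightarrow> 'a list \<Rightarrow> 'a list" where
  "hurwitz_move G c n i = (\<lambda>xs \<in> tuples c n.
     xs[i := xs ! i \<otimes>\<^bsub>G\<^esub> xs ! Suc i \<otimes>\<^bsub>G\<^esub> inv\<^bsub>G\<^esub> (xs ! i), Suc i := xs ! i])"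

text \<open>The image of the braid group in the permutation group of the set of \<open>n\<close>-tuples; it has
  the same orbits as the braid group.\<close>

definition hurwitz_group ::
    "('a, 'b) monoid_scheme \<Rightarrow> 'a set \<Rightarrow> nat \<Rightarrow> ('a list \<Rightarrow> 'a list) monoid" where
  "hurwitz_group G c n = (BijGroup (tuples c n))
     \<lparr>carrier := generate (BijGroup (tuples c n)) {hurwitz_move G c n i | i. Suc i < n}\<rparr>"

definition hurwitz_orbits :: "('a, 'b) monoid_scheme \<Rightarrow> 'a set \<Rightarrow> nat \<Rightarrow> 'a list set set" where
  "hurwitz_orbits G c n = orbits (hurwitz_group G c n) (tuples c n) (\<lambda>g. g)"

definition hurwitz_class :: "('a, 'b) monoid_scheme \<Rightarrow> 'a set \<Rightarrow> 'a list \<Rightarrow> 'a list set" where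
  "hurwitz_class G c xs = orbit (hurwitz_group G c (length xs)) (\<lambda>g. g) xs"

text \<open>The orbit of a concatenation does not depend on the chosen representatives, so the
  following is a union of copies of one orbit.\<close>

definition concat_orbit ::
    "('a, 'b) monoid_scheme \<Rightarrow> 'a set \<Rightarrow> 'a list set \<Rightarrow> 'a list set \<Rightarrow> 'a list set" where
  "concat_orbit G c A B = (\<Union>xs \<in> A. \<Union>ys \<in> B. hurwitz_class G c (xs @ ys))"


subsection \<open>The graded algebra spanned by the orbits\<close>

definition hurwitz_algebra ::
    "('a, 'b) monoid_scheme \<Rightarrow> 'a set \<Rightarrow> ('a list set \<Rightarrow>\<^sub>0 'k::field) ring" where
  "hurwitz_algebra G c =
     \<lparr>carrier = {f. Poly_Mapping.keys f \<subseteq> (\<Union>n. hurwitz_orbits G c n)},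
      monoid.mult = (\<lambda>f g. \<Sum>A \<in> Poly_Mapping.keys f. \<Sum>B \<in> Poly_Mapping.keys g.
                Poly_Mapping.single (concat_orbit G c A B)
                  (Poly_Mapping.lookup f A * Poly_Mapping.lookup g B)),
      monoid.one = Poly_Mapping.single (hurwitz_class G c []) 1,
      ring.zero = 0,
      ring.add = (+)\<rparr>"

definition hurwitz_part ::
    "('a, 'b) monoid_scheme \<Rightarrow> 'a set \<Rightarrow> nat \<Rightarrow> ('a list set \<Rightarrow>\<^sub>0 'k::field) set" where
  "hurwitz_part G c n = {f. Poly_Mapping.keys f \<subseteq> hurwitz_orbits G c n}"

definition hurwitz_gen ::
    "('a, 'b) monoid_scheme \<Rightarrow> 'a set \<Rightarrow> 'a \<Rightarrow> ('a list set \<Rightarrow>\<^sub>0 'k::field)" where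
  "hurwitz_gen G c h = Poly_Mapping.single (hurwitz_class G c [h]) 1"

definition hurwitz_U ::
    "('a, 'b) monoid_scheme \<Rightarrow> 'a set \<Rightarrow> nat \<Rightarrow> ('a list set \<Rightarrow>\<^sub>0 'k::field)" where
  "hurwitz_U G c D =
     (\<Oplus>\<^bsub>hurwitz_algebra G c\<^esub> h \<in> c.
        hurwitz_gen G c h [^]\<^bsub>hurwitz_algebra G c\<^esub> (D * group.ord G h))"


subsection \<open>Graded rings and modules\<close>

text \<open>A grading is given by the family of its homogeneous parts.\<close>

definition homogeneous :: "(nat \<Rightarrow> 'r set) \<Rightarrow> 'r \<Rightarrow> bool" where
  "homogeneous P x \<longleftrightarrow> (\<exists>n. x \<in> P n)"

definition non_invertible :: "('r, 'm) ring_scheme \<Rightarrow> (nat \<Rightarrow> 'r set) \<Rightarrow> 'r \<Rightarrow> bool" where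
  "non_invertible R P x \<longleftrightarrow> (\<exists>n>0. x \<in> P n) \<or> x = \<zero>\<^bsub>R\<^esub>"

definition central :: "('r, 'm) ring_scheme \<Rightarrow> 'r \<Rightarrow> bool" where
  "central R x \<longleftrightarrow> x \<in> carrier R \<and> (\<forall>y \<in> carrier R. x \<otimes>\<^bsub>R\<^esub> y = y \<otimes>\<^bsub>R\<^esub> x)"

text \<open>The supremum is taken in the extended reals; the zero module has degree \<open>-\<infinity>\<close>.\<close>

definition graded_degree :: "'m \<Rightarrow> (nat \<Rightarrow> 'm set) \<Rightarrow> ereal" where
  "graded_degree z M = (SUP n \<in> {n. M n \<noteq> {z}}. ereal (real n))"

definition mult_kernel :: "('r, 'm) ring_scheme \<Rightarrow> 'r \<Rightarrow> 'r set" where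
  "mult_kernel R u = a_kernel R R (\<lambda>x. x \<otimes>\<^bsub>R\<^esub> u)"

definition mult_image :: "('r, 'm) ring_scheme \<Rightarrow> 'r \<Rightarrow> 'r set" where
  "mult_image R u = (\<lambda>x. x \<otimes>\<^bsub>R\<^esub> u) ` carrier R"

definition mult_cokernel :: "('r, 'm) ring_scheme \<Rightarrow> 'r \<Rightarrow> 'r set monoid" where
  "mult_cokernel R u = R A_Mod mult_image R u"

definition kernel_degree :: "('r, 'm) ring_scheme \<Rightarrow> (nat \<Rightarrow> 'r set) \<Rightarrow> 'r \<Rightarrow> ereal" where
  "kernel_degree R P u = graded_degree \<zero>\<^bsub>R\<^esub> (\<lambda>n. mult_kernel R u \<inter> P n)"

text \<open>The degree \<open>n\<close> part of the cokernel is the image of the degree \<open>n\<close> part of the ring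
  under the quotient map.\<close>

definition cokernel_degree :: "('r, 'm) ring_scheme \<Rightarrow> (nat \<Rightarrow> 'r set) \<Rightarrow> 'r \<Rightarrow> ereal" where
  "cokernel_degree R P u =
     graded_degree \<one>\<^bsub>mult_cokernel R u\<^esub> (\<lambda>n. (\<lambda>x. mult_image R u +>\<^bsub>R\<^esub> x) ` P n)"

end

theory Submission
  imports Defs
begin

text \<open>Let \<open>m\<close> be \<open>D\<close> times the common order of the elements of \<open>c\<close>, so that \<open>h\<^sup>m = 1\<close> for every \<open>h \<in> c\<close>.
  Words over \<open>c\<close> are considered up to the Hurwitz moves; the orbit of a word \<open>s\<close> is a basis element
  of the algebra, and the subgroup \<open>\<langle>s\<rangle>\<close> generated by the entries of \<open>s\<close> is an invariant of the orbit.

  A block \<open>h\<^sup>m = (h, \<dots>, h)\<close> has trivial product and therefore commutes with every word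
  (\<open>replicate_commute\<close>), which makes \<open>U = \<Sum>\<^sub>h h\<^sup>m\<close> central. Moving an entry \<open>x\<close> of \<open>s\<close> through the
  block replaces \<open>h\<close> by \<open>xhx\<^sup>-\<^sup>1\<close>, so \<open>s h\<^sup>m \<sim> s (ghg\<^sup>-\<^sup>1)\<^sup>m\<close> for all \<open>g \<in> \<langle>s\<rangle>\<close>
  (\<open>replicate_conj_generate\<close>). If \<open>s\<close> is longer than \<open>|c| m\<close>, some \<open>h\<close> occurs in it more than \<open>m\<close>
  times, and collecting \<open>m\<close> copies gives \<open>s \<sim> s' h\<^sup>m\<close> with \<open>\<langle>s'\<rangle> = \<langle>s\<rangle>\<close>. Let \<open>K = \<langle>s\<rangle>\<close>. Since
  \<open>c \<inter> K\<close> is a single conjugacy class of \<open>K\<close>, the block can be any \<open>g\<^sup>m\<close> with \<open>g \<in> c \<inter> K\<close>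
  (\<open>long_tuple_splits_off_power\<close>). Consequently, on orbits of long words generating \<open>K\<close>, appending \<open>g\<close>
  and appending \<open>g\<^sup>m\<close> are surjective; the finite number of such orbits does not increase with the length,
  hence becomes constant, and appending \<open>g\<^sup>m\<close> becomes bijective (\<open>eventually_cancel_power\<close>).

  For a word \<open>s\<close> generating \<open>K\<close> and \<open>g \<in> c \<inter> K\<close>, the product \<open>s U\<close> equals \<open>|c \<inter> K| s g\<^sup>m\<close> plus orbits
  of words generating strictly larger subgroups. So multiplication by \<open>U\<close> is triangular with respect
  to the generated subgroup, and in large degrees its diagonal blocks are bijections of bases times
  scalars \<open>|c \<inter> K|\<close> that are nonzero in the field. It is thus surjective
  (\<open>long_part_subset_image\<close>) and injective (\<open>kernel_trivial\<close>) in large degrees.\<close>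

section \<open>Hurwitz equivalence\<close>

locale conjugation_invariant_subset = group G for G (structure) +
  fixes c :: "'a set"
  assumes sub: "c \<subseteq> carrier G"
    and conj_mem: "\<lbrakk>g \<in> carrier G; x \<in> c\<rbrakk> \<Longrightarrow> g \<otimes> x \<otimes> inv g \<in> c"
begin

text \<open>Conjugation of \<open>x\<close> by \<open>g\<close>.\<close>

definition cj :: "'a \<Rightarrow> 'a \<Rightarrow> 'a" where
  "cj g x = g \<otimes> x \<otimes> inv g"

lemma mem_carrier [simp]: "x \<in> c \<Longrightarrow> x \<in> carrier G"
  using sub by blast

lemma cj_mem [simp]: "\<lbrakk>g \<in> carrier G; x \<in> c\<rbrakk> \<Longrightarrow> cj g x \<in> c"
  by (simp add: cj_def conj_mem)

lemma cj_closed [simp]: "\<lbrakk>g \<in> carrier G; x \<in> carrier G\<rbrakk> \<Longrightarrow> cj g x \<in> carrier G"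
  by (simp add: cj_def)

lemma cj_cj: "\<lbrakk>g \<in> carrier G; h \<in> carrier G; x \<in> carrier G\<rbrakk> \<Longrightarrow> cj g (cj h x) = cj (g \<otimes> h) x"
  by (simp add: cj_def m_assoc inv_mult_group)

lemma cj_one [simp]: "x \<in> carrier G \<Longrightarrow> cj \<one> x = x"
  by (simp add: cj_def)

lemma cj_self [simp]: "x \<in> carrier G \<Longrightarrow> cj x x = x"
  by (simp add: cj_def m_assoc)

lemma cj_inv_cj [simp]: "\<lbrakk>g \<in> carrier G; x \<in> carrier G\<rbrakk> \<Longrightarrow> cj (inv g) (cj g x) = x"
  by (simp add: cj_cj)

lemma cj_cj_inv [simp]: "\<lbrakk>g \<in> carrier G; x \<in> carrier G\<rbrakk> \<Longrightarrow> cj g (cj (inv g) x) = x"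
  by (simp add: cj_cj)

lemma inj_on_cj: "g \<in> carrier G \<Longrightarrow> inj_on (cj g) (carrier G)"
  by (rule inj_on_inverseI[where g = "cj (inv g)"]) simp

lemma cj_of_one [simp]: "g \<in> carrier G \<Longrightarrow> cj g \<one> = \<one>"
  by (simp add: cj_def)

lemma cj_pow [simp]: "\<lbrakk>g \<in> carrier G; x \<in> carrier G\<rbrakk> \<Longrightarrow> cj g x [^] (n::nat) = cj g (x [^] n)"
proof (induction n)
  case 0 then show ?case by (simp add: cj_def)
next
  case (Suc n)
  then show ?case
    by (simp add: cj_def m_assoc) (simp flip: m_assoc)
qed

text \<open>Hurwitz equivalence, presented as the congruence on words generated by the moves
  \<open>(a, b) \<mapsto> (aba\<^sup>-\<^sup>1, a)\<close>. No condition is put on the words, so that it is reflexive on all lists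
  and compatible with concatenation; on words over \<open>c\<close> its classes are the braid group orbits
  (\<open>hurwitz_class_eq\<close> below).\<close>

inductive heq :: "'a list \<Rightarrow> 'a list \<Rightarrow> bool" where
  refl: "heq xs xs"
| sym: "heq xs ys \<Longrightarrow> heq ys xs"
| trans: "heq xs ys \<Longrightarrow> heq ys zs \<Longrightarrow> heq xs zs"
| move: "a \<in> c \<Longrightarrow> b \<in> c \<Longrightarrow> heq (u @ [a, b] @ v) (u @ [cj a b, a] @ v)"

declare heq.refl [simp, intro]
lemmas [trans] = heq.trans

lemma heq_length: "heq xs ys \<Longrightarrow> length xs = length ys"
  by (induction rule: heq.induct) auto

lemma heq_subset: "heq xs ys \<Longrightarrow> set xs \<subseteq> c \<longleftrightarrow> set ys \<subseteq> c"
  by (induction rule: heq.induct) auto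

lemma heq_tuples: "heq xs ys \<Longrightarrow> xs \<in> tuples c n \<longleftrightarrow> ys \<in> tuples c n"
  using heq_subset heq_length by (fastforce simp: tuples_def)

lemma heq_cong: "heq xs ys \<Longrightarrow> heq (u @ xs @ v) (u @ ys @ v)"
proof (induction rule: heq.induct)
  case (move a b u' v')
  then show ?case using heq.move[of a b "u @ u'" "v' @ v"] by simp
qed (auto intro: heq.sym heq.trans)

lemma heq_append: "heq xs xs' \<Longrightarrow> heq ys ys' \<Longrightarrow> heq (xs @ ys) (xs' @ ys')"
  using heq_cong[of xs xs' "[]" ys] heq_cong[of ys ys' xs' "[]"] by (auto intro: heq.trans)

text \<open>The subgroup generated by the entries is therefore an invariant of an orbit.\<close>

lemma heq_generate:
  assumes "heq xs ys" "set xs \<subseteq> c"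
  shows "generate G (set xs) = generate G (set ys)"
  using assms
proof (induction rule: heq.induct)
  case (sym xs ys)
  then show ?case using heq_subset by blast
next
  case (trans xs ys zs)
  then show ?case using heq_subset by blast
next
  case (move a b u v)
  let ?A = "set (u @ [a, b] @ v)" and ?B = "set (u @ [cj a b, a] @ v)"
  have AB: "?A \<subseteq> carrier G" "?B \<subseteq> carrier G"
    using move sub by auto
  interpret A: subgroup "generate G ?A" G by (rule generate_is_subgroup[OF AB(1)])
  interpret B: subgroup "generate G ?B" G by (rule generate_is_subgroup[OF AB(2)])
  have "cj a b \<in> generate G ?A"
    unfolding cj_def by (intro A.m_closed A.m_inv_closed generate.incl) auto
  then have "?B \<subseteq> generate G ?A"
    by (auto intro: generate.incl)
  moreover have "cj (inv a) (cj a b) \<in> generate G ?B"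
    unfolding cj_def[of "inv a"]
    by (intro B.m_closed B.m_inv_closed generate.incl) auto
  then have "?A \<subseteq> generate G ?B"
    using move by (auto intro: generate.incl)
  ultimately show ?case
    using generate_subgroup_incl A.subgroup_axioms B.subgroup_axioms by blast
qed auto

lemma hurwitz_move_append:
  assumes "set u \<subseteq> c" "set v \<subseteq> c" "a \<in> c" "b \<in> c" "n = length (u @ [a, b] @ v)"
  shows "hurwitz_move G c n (length u) (u @ [a, b] @ v) = u @ [cj a b, a] @ v"
  using assms by (simp add: hurwitz_move_def tuples_def cj_def nth_append list_update_append)

lemma tuple_split:
  assumes "xs \<in> tuples c n" "Suc i < n"
  obtains u a b v where "xs = u @ [a, b] @ v" "length u = i"
    "set u \<subseteq> c" "set v \<subseteq> c" "a \<in> c" "b \<in> c" "n = length (u @ [a, b] @ v)"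
proof -
  have l: "length xs = n" "set xs \<subseteq> c" using assms(1) by (auto simp: tuples_def)
  have e: "xs = take i xs @ [xs ! i, xs ! Suc i] @ drop (Suc (Suc i)) xs"
    using assms(2) l by (simp add: Cons_nth_drop_Suc)
  have "length (take i xs) = i" using assms(2) l by simp
  moreover have "set (take i xs) \<subseteq> c" "set (drop (Suc (Suc i)) xs) \<subseteq> c" "xs ! i \<in> c" "xs ! Suc i \<in> c"
    using l assms(2) set_take_subset[of i xs] set_drop_subset[of "Suc (Suc i)" xs] nth_mem[of i xs]
      nth_mem[of "Suc i" xs] by auto
  ultimately show ?thesis using that[OF e] l e by metis
qed

lemma hurwitz_move_heq:
  assumes "xs \<in> tuples c n" "Suc i < n"
  shows "heq xs (hurwitz_move G c n i xs)"
  using assms(1)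
  by (rule tuple_split[OF _ assms(2)]) (use hurwitz_move_append heq.move in metis)

lemma hurwitz_move_Bij:
  assumes "Suc i < n"
  shows "hurwitz_move G c n i \<in> Bij (tuples c n)"
proof -
  let ?T = "tuples c n" and ?f = "hurwitz_move G c n i"
  \<comment> \<open>The inverse move \<open>(a, b) \<mapsto> (b, b\<^sup>-\<^sup>1ab)\<close>.\<close>
  define h where "h xs = xs[i := xs ! Suc i, Suc i := cj (inv (xs ! Suc i)) (xs ! i)]" for xs
  have mem: "?f xs \<in> ?T" if "xs \<in> ?T" for xs
    using hurwitz_move_heq[OF that assms] heq_tuples that by blast
  have hmem: "h xs \<in> ?T \<and> ?f (h xs) = xs" if xs: "xs \<in> ?T" for xs
  proof -
    obtain u a b v where *: "xs = u @ [a, b] @ v" "length u = i"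
      "set u \<subseteq> c" "set v \<subseteq> c" "a \<in> c" "b \<in> c" "n = length (u @ [a, b] @ v)"
      using tuple_split[OF xs assms] .
    have h: "h xs = u @ [b, cj (inv b) a] @ v"
      using * by (simp add: h_def nth_append list_update_append)
    show ?thesis
      using * hurwitz_move_append[of u v b "cj (inv b) a" n] unfolding h
      by (auto simp: tuples_def)
  qed
  have hf: "h (?f xs) = xs" if xs: "xs \<in> ?T" for xs
  proof -
    obtain u a b v where *: "xs = u @ [a, b] @ v" "length u = i"
      "set u \<subseteq> c" "set v \<subseteq> c" "a \<in> c" "b \<in> c" "n = length (u @ [a, b] @ v)"
      using tuple_split[OF xs assms] .
    then show ?thesis
      using hurwitz_move_append[of u v a b n] by (simp add: h_def nth_append list_update_append)
  qed
  have "bij_betw ?f ?T ?T"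
    by (rule bij_betw_byWitness[where f' = h]) (use mem hmem hf in auto)
  moreover have "?f \<in> extensional ?T"
    by (simp add: hurwitz_move_def)
  ultimately show ?thesis by (simp add: Bij_def)
qed

text \<open>Both inclusions are inductions: one over words in the generators of the permutation group,
  the other over the derivation of an equivalence.\<close>

lemma hurwitz_class_eq:
  assumes xs: "set xs \<subseteq> c"
  shows "hurwitz_class G c xs = {ys. heq xs ys}"
proof -
  define n where "n = length xs"
  define T where "T = tuples c n"
  define M where "M = {hurwitz_move G c n i | i. Suc i < n}"
  define H where "H = generate (BijGroup T) M"
  have xT: "xs \<in> T" using xs by (simp add: T_def n_def tuples_def)
  interpret B: group "BijGroup T" by (rule group_BijGroup)
  have M: "M \<subseteq> carrier (BijGroup T)"
    using hurwitz_move_Bij by (auto simp: M_def T_def BijGroup_def)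
  interpret H: subgroup H "BijGroup T"
    unfolding H_def by (rule B.generate_is_subgroup[OF M])
  have HB: "g \<in> Bij T" if "g \<in> H" for g
    using H.subset that by (auto simp: BijGroup_def)
  have mult: "(g \<otimes>\<^bsub>BijGroup T\<^esub> h) ys = g (h ys)" if "g \<in> H" "h \<in> H" "ys \<in> T" for g h ys
    using HB that by (simp add: BijGroup_def compose_def)
  have invB: "inv\<^bsub>BijGroup T\<^esub> g \<in> H" if "g \<in> H" for g
    by (rule H.m_inv_closed[OF that])
  have invl: "(inv\<^bsub>BijGroup T\<^esub> g) (g ys) = ys" if "g \<in> H" "ys \<in> T" for g ys
    unfolding mult[OF invB[OF that(1)] that, symmetric] B.l_inv[OF H.mem_carrier[OF that(1)]]
    using that by (simp add: BijGroup_def)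
  have invr: "g ((inv\<^bsub>BijGroup T\<^esub> g) ys) = ys" if "g \<in> H" "ys \<in> T" for g ys
    unfolding mult[OF that(1) invB[OF that(1)] that(2), symmetric] B.r_inv[OF H.mem_carrier[OF that(1)]]
    using that by (simp add: BijGroup_def)
  have into: "heq ys (g ys)" if "g \<in> H" "ys \<in> T" for g ys
    using that unfolding H_def
  proof (induction arbitrary: ys rule: generate.induct)
    case one
    then show ?case by (simp add: BijGroup_def)
  next
    case (incl h)
    then show ?case using hurwitz_move_heq by (auto simp: M_def T_def)
  next
    case (inv h)
    let ?i = "inv\<^bsub>BijGroup T\<^esub> h"
    have hH: "h \<in> H" using inv by (simp add: H_def generate.incl)
    have i: "?i ys \<in> T" "h (?i ys) = ys"
      using Bij_imp_funcset[OF HB[OF invB[OF hH]]] inv invr[OF hH] by auto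
    obtain j where j: "Suc j < n" "h = hurwitz_move G c n j" using inv by (auto simp: M_def)
    have "heq (?i ys) (h (?i ys))"
      using hurwitz_move_heq[OF i(1)[unfolded T_def] j(1)] unfolding j(2) T_def .
    then show ?case using i by (simp add: heq.sym)
  next
    case (eng h1 h2)
    have "h2 ys \<in> T" using eng heq_tuples unfolding T_def by blast
    then show ?case using eng mult[unfolded H_def] by (auto intro: heq.trans)
  qed
  have onto: "\<exists>g\<in>H. zs = g ys" if "heq ys zs" "ys \<in> T" for ys zs
    using that
  proof (induction rule: heq.induct)
    case (refl xs)
    then show ?case by (intro bexI[OF _ H.one_closed]) (simp add: BijGroup_def)
  next
    case (sym xs ys)
    then have "xs \<in> T" using heq_tuples T_def by blast
    then obtain g where "g \<in> H" "ys = g xs" using sym by blast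
    then show ?case
      using invl[OF _ \<open>xs \<in> T\<close>] invB by metis
  next
    case (trans xs ys zs)
    then have "ys \<in> T" using heq_tuples T_def by blast
    then obtain g h where "g \<in> H" "h \<in> H" "zs = g ys" "ys = h xs" using trans by blast
    then show ?case
      using mult[of g h xs] trans.prems by (intro bexI[OF _ H.m_closed[of g h]]) simp_all
  next
    case (move a b u v)
    let ?f = "hurwitz_move G c n (length u)"
    have "?f \<in> H"
      unfolding H_def M_def
      by (rule generate.incl) (use move in \<open>auto simp: T_def tuples_def\<close>)
    moreover have "u @ [cj a b, a] @ v = ?f (u @ [a, b] @ v)"
      using move by (subst hurwitz_move_append) (auto simp: T_def tuples_def)
    ultimately show ?case by blast
  qed
  have "hurwitz_class G c xs = {g xs | g. g \<in> H}"
    by (simp add: hurwitz_class_def orbit_def hurwitz_group_def H_def M_def T_def n_def)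
  also have "\<dots> = {ys. heq xs ys}" using into onto xT by blast
  finally show ?thesis .
qed

lemma hurwitz_class_eq_iff:
  assumes "set xs \<subseteq> c" "set ys \<subseteq> c"
  shows "hurwitz_class G c xs = hurwitz_class G c ys \<longleftrightarrow> heq xs ys"
  using assms by (auto simp: hurwitz_class_eq intro: heq.sym heq.trans)

lemma hurwitz_orbits_eq: "hurwitz_orbits G c n = hurwitz_class G c ` tuples c n"
  by (auto simp: hurwitz_orbits_def orbits_def hurwitz_class_def tuples_def)

lemma concat_orbit_class:
  assumes "set xs \<subseteq> c" "set ys \<subseteq> c"
  shows "concat_orbit G c (hurwitz_class G c xs) (hurwitz_class G c ys) = hurwitz_class G c (xs @ ys)"
proof -
  have "hurwitz_class G c (us @ vs) = hurwitz_class G c (xs @ ys)"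
    if "heq xs us" "heq ys vs" for us vs
    using that assms heq_subset heq_append[OF that]
    by (subst hurwitz_class_eq_iff) (auto intro: heq.sym)
  then show ?thesis
    using assms by (auto simp: concat_orbit_def hurwitz_class_eq)
qed

section \<open>Moving entries through a tuple\<close>

lemma heq_Cons_move: "h \<in> c \<Longrightarrow> set xs \<subseteq> c \<Longrightarrow> heq (h # xs) (map (cj h) xs @ [h])"
proof (induction xs)
  case (Cons x xs)
  have "heq (h # x # xs) (cj h x # h # xs)"
    using heq.move[of h x "[]" xs] Cons by simp
  also have "heq \<dots> (cj h x # map (cj h) xs @ [h])"
    using heq_cong[of "h # xs" "map (cj h) xs @ [h]" "[cj h x]" "[]"] Cons by simp
  finally show ?case by simp
qed simp

lemma heq_replicate_single:
  assumes "h \<in> c" "x \<in> c"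
  shows "heq (replicate n h @ [x]) (cj (h [^] n) x # replicate n h)"
proof (induction n)
  case 0
  then show ?case using assms by simp
next
  case (Suc n)
  have "heq (replicate (Suc n) h @ [x]) (h # cj (h [^] n) x # replicate n h)"
    using heq_cong[OF Suc, of "[h]" "[]"] by simp
  also have "heq \<dots> (cj h (cj (h [^] n) x) # h # replicate n h)"
    using heq.move[of h "cj (h [^] n) x" "[]"] assms by simp
  also have "cj h (cj (h [^] n) x) = cj (h [^] Suc n) x"
    using assms by (simp only: cj_cj mem_carrier nat_pow_closed flip: nat_pow_Suc2)
  finally show ?case by simp
qed

text \<open>A block \<open>h\<^sup>m\<close> with trivial product conjugates nothing, hence commutes with every tuple.\<close>

lemma replicate_commute:
  assumes "h \<in> c" "h [^] (m::nat) = \<one>" "set xs \<subseteq> c"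
  shows "heq (replicate m h @ xs) (xs @ replicate m h)"
  using assms(3)
proof (induction xs)
  case (Cons x xs)
  have "heq (replicate m h @ [x]) (x # replicate m h)"
    using heq_replicate_single[OF assms(1), of x m] Cons assms by simp
  from heq_cong[OF this, of "[]" xs]
  have "heq (replicate m h @ x # xs) (x # replicate m h @ xs)" by simp
  also have "heq \<dots> (x # xs @ replicate m h)"
    using heq_cong[of "replicate m h @ xs" _ "[x]" "[]"] Cons by auto
  finally show ?case by simp
qed simp

text \<open>Passing \<open>x\<close> to the right through \<open>h\<^sup>m\<close> conjugates each \<open>h\<close> by \<open>x\<close>; since the resulting block is
  again central, it can be brought back without any further change.\<close>

lemma replicate_conj_single:
  assumes x: "x \<in> c" and h: "h \<in> c" "h [^] (m::nat) = \<one>"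
  shows "heq ([x] @ replicate m h) ([x] @ replicate m (cj x h))"
proof -
  have "heq ([x] @ replicate m h) (replicate m (cj x h) @ [x])"
    using heq_Cons_move[OF x, of "replicate m h"] h by (simp add: set_replicate_conv_if)
  also have "heq \<dots> ([x] @ replicate m (cj x h))"
    by (rule replicate_commute) (use x h in auto)
  finally show ?thesis .
qed

lemma replicate_conj_mem:
  assumes xs: "set xs \<subseteq> c" and x: "x \<in> set xs" and h: "h \<in> c" "h [^] (m::nat) = \<one>"
  shows "heq (xs @ replicate m h) (xs @ replicate m (cj x h))"
proof -
  obtain u v where uv: "xs = u @ x # v" using x by (meson split_list)
  have xc: "x \<in> c" "set v \<subseteq> c" "set u \<subseteq> c" using xs uv by auto
  have h': "cj x h \<in> c" "cj x h [^] m = \<one>"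
    using xc h by auto
  have comm: "heq (u @ x # v @ replicate m g) (u @ [x] @ replicate m g @ v)"
    if "g \<in> c" "g [^] m = \<one>" for g
    using heq_cong[OF heq.sym[OF replicate_commute[OF that xc(2)]], of "u @ [x]" "[]"] by simp
  have "heq (u @ x # v @ replicate m h) (u @ [x] @ replicate m h @ v)"
    by (rule comm[OF h])
  also have "heq \<dots> (u @ [x] @ replicate m (cj x h) @ v)"
    using heq_cong[OF replicate_conj_single[OF xc(1) h], of u v] by simp
  also have "heq \<dots> (u @ x # v @ replicate m (cj x h))"
    by (rule heq.sym[OF comm[OF h']])
  finally show ?thesis by (simp add: uv)
qed

text \<open>A central block following a tuple may be conjugated by every element of the subgroup that the
  tuple generates.\<close>

lemma replicate_conj_generate:
  assumes xs: "set xs \<subseteq> c" and g: "g \<in> generate G (set xs)" and h: "h \<in> c" "h [^] (m::nat) = \<one>"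
  shows "heq (xs @ replicate m h) (xs @ replicate m (cj g h))"
  using g h
proof (induction arbitrary: h rule: generate.induct)
  case one
  then show ?case by simp
next
  case (incl x)
  then show ?case using replicate_conj_mem xs by simp
next
  case (inv x)
  have x: "x \<in> carrier G" using xs inv by auto
  have "heq (xs @ replicate m (cj (inv x) h)) (xs @ replicate m (cj x (cj (inv x) h)))"
    by (rule replicate_conj_mem) (use inv xs x in auto)
  then show ?case using inv x by (simp add: heq.sym)
next
  case (eng g1 g2)
  have g: "g1 \<in> carrier G" "g2 \<in> carrier G"
    using eng generate_in_carrier[of "set xs"] xs by (auto simp: subset_iff)
  have "heq (xs @ replicate m h) (xs @ replicate m (cj g2 h))" using eng by simp
  also have "heq \<dots> (xs @ replicate m (cj g1 (cj g2 h)))"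
    by (rule eng.IH(1)) (use eng g in auto)
  finally show ?case using g eng by (simp add: cj_cj)
qed

text \<open>Copies of \<open>h\<close> can be collected at the right end. Entries that are passed are conjugated by
  \<open>h\<close>, which does not change the number of entries equal to \<open>h\<close>.\<close>

lemma collect_entry:
  assumes "h \<in> c" "set xs \<subseteq> c" "k \<le> count_list xs h"
  shows "\<exists>ys. heq xs (ys @ replicate k h) \<and> set ys \<subseteq> c \<and> count_list ys h + k = count_list xs h"
  using assms(3)
proof (induction k)
  case 0
  then show ?case using assms by (auto intro!: exI[of _ xs])
next
  case (Suc k)
  then obtain ys where ys: "heq xs (ys @ replicate k h)" "set ys \<subseteq> c" "count_list ys h + k = count_list xs h"
    by auto
  then have "h \<in> set ys" using Suc.prems count_list_0_iff[of ys h] by fastforce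
  then obtain u v where uv: "ys = u @ h # v" by (meson split_list)
  have v: "set v \<subseteq> c" "set u \<subseteq> c" using uv ys by auto
  have "heq ys (u @ map (cj h) v @ [h])"
    using heq_cong[OF heq_Cons_move[OF assms(1) v(1)], of u "[]"] uv by simp
  from heq_cong[OF this, of "[]" "replicate k h"]
  have "heq xs ((u @ map (cj h) v) @ replicate (Suc k) h)"
    using ys(1) by (auto intro: heq.trans)
  moreover have "set (u @ map (cj h) v) \<subseteq> c" using v assms by auto
  moreover have "count_list (map (cj h) v) h = count_list v h"
  proof (cases "h \<in> set v")
    case True
    then show ?thesis
      using count_list_inj_map[of "cj h" v h] assms(1) v inj_on_subset[OF inj_on_cj[of h], of "set v"]
      by (auto simp: subset_iff)
  next
    case False
    have "h \<notin> set (map (cj h) v)"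
    proof
      assume "h \<in> set (map (cj h) v)"
      then obtain x where x: "x \<in> set v" "cj h h = cj h x" using assms by auto
      then have "h = x" using inj_onD[OF inj_on_cj[of h] x(2)] assms v by auto
      then show False using x False by simp
    qed
    then show ?thesis using False by simp
  qed
  ultimately show ?case using ys uv by (intro exI[of _ "u @ map (cj h) v"]) auto
qed

section \<open>Splitting powers off long tuples\<close>

lemma generate_insert_mem:
  assumes "set xs \<subseteq> c" "g \<in> generate G (set xs)"
  shows "generate G (insert g (set xs)) = generate G (set xs)"
proof
  have "set xs \<subseteq> carrier G" using assms sub by auto
  then show "generate G (insert g (set xs)) \<subseteq> generate G (set xs)"
    using assms by (intro generate_subgroup_incl generate_is_subgroup) (auto intro: generate.incl)
qed (intro mono_generate, auto)

text \<open>By the pigeonhole principle some \<open>h\<close> occurs more than \<open>m\<close> times. Collecting only \<open>m\<close> of these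
  copies leaves an entry \<open>h\<close> behind, which ensures that the remaining tuple still generates the
  same subgroup.\<close>

lemma long_tuple_repeats:
  assumes fin: "finite c" and m: "m > 0" "\<And>h. h \<in> c \<Longrightarrow> h [^] (m::nat) = \<one>"
    and xs: "set xs \<subseteq> c" "length xs > card c * m"
  shows "\<exists>h ys. h \<in> c \<and> set ys \<subseteq> c \<and> h \<in> set ys \<and> heq xs (ys @ replicate m h)"
proof -
  have "\<exists>h\<in>c. count_list xs h > m"
  proof (rule ccontr)
    assume "\<not> ?thesis"
    then have "sum (count_list xs) c \<le> card c * m"
      using sum_bounded_above[of c "count_list xs" m] by (simp add: not_less)
    then show False using sum_count_set[OF xs(1) fin] xs(2) by simp
  qed
  then obtain h where h: "h \<in> c" "count_list xs h > m" by blast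
  then obtain ys where "heq xs (ys @ replicate m h)" "set ys \<subseteq> c" "count_list ys h + m = count_list xs h"
    using collect_entry[OF h(1) xs(1), of m] by auto
  moreover from this h have "h \<in> set ys" using count_list_0_iff[of ys h] by fastforce
  ultimately show ?thesis using h by blast
qed

text \<open>If \<open>c \<inter> K\<close> is a single \<open>K\<close>-class, the block that is split off can be chosen freely.\<close>

lemma long_tuple_splits_off_power:
  assumes fin: "finite c" and m: "m > 0" "\<And>h. h \<in> c \<Longrightarrow> h [^] (m::nat) = \<one>"
    and xs: "set xs \<subseteq> c" "length xs > card c * m"
    and K: "K = generate G (set xs)" and g: "g \<in> c \<inter> K"
    and trans: "\<And>h. h \<in> c \<inter> K \<Longrightarrow> \<exists>a\<in>K. g = cj a h"
  shows "\<exists>ys. set ys \<subseteq> c \<and> generate G (set ys) = K \<and> heq xs (ys @ replicate m g)"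
proof -
  obtain h ys where *: "h \<in> c" "set ys \<subseteq> c" "h \<in> set ys" "heq xs (ys @ replicate m h)"
    using long_tuple_repeats[OF fin m xs] by auto
  have "insert h (set ys) = set ys" using * by auto
  then have gen: "generate G (set ys) = K"
    using heq_generate[OF *(4) xs(1)] K m * by (simp add: set_replicate_conv_if)
  then have "h \<in> K" using *(3) by (auto intro: generate.incl)
  then obtain a where a: "a \<in> K" "g = cj a h" using trans * by blast
  have "heq (ys @ replicate m h) (ys @ replicate m g)"
    unfolding a(2) by (rule replicate_conj_generate) (use * a gen m in auto)
  then show ?thesis using * gen heq.trans by blast
qed

end

section \<open>Stabilisation of the set of orbits\<close>

lemma eventually_constant_of_antimono:
  fixes f :: "nat \<Rightarrow> nat"
  assumes "\<And>n. N0 \<le> n \<Longrightarrow> f (Suc n) \<le> f n"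
  shows "\<exists>N\<ge>N0. \<forall>n\<ge>N. f n = f N"
proof -
  obtain N where N: "N0 \<le> N" "\<And>n. N0 \<le> n \<Longrightarrow> f N \<le> f n"
    using ex_has_least_nat[of "\<lambda>n. N0 \<le> n" N0 f] by auto
  have "f n \<le> f N" if "n \<ge> N" for n
    using that by (induction rule: dec_induct) (use assms N(1) in \<open>auto intro: le_trans\<close>)
  then show ?thesis using N by (intro exI[of _ N]) (auto intro: antisym)
qed

text \<open>A conjugation invariant subset \<open>c\<close> of a finite group that meets every subgroup \<open>K\<close> in at most one \<open>K\<close>-class, together
  with a positive common exponent \<open>m\<close> of its elements.\<close>

locale non_splitting_class = conjugation_invariant_subset +
  fixes m :: nat
  assumes finite_carrier: "finite (carrier G)"
    and transitive: "\<lbrakk>subgroup K G; g \<in> c \<inter> K; h \<in> c \<inter> K\<rbrakk> \<Longrightarrow> \<exists>a\<in>K. g = a \<otimes> h \<otimes> inv a"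
    and m_pos: "m > 0"
    and pow_m: "h \<in> c \<Longrightarrow> h [^] m = \<one>"
begin

lemma finite_c: "finite c"
  using finite_carrier sub finite_subset by blast

text \<open>The tuple \<open>(h, \<dots>, h)\<close> of length \<open>m\<close>.\<close>

abbreviation pw :: "'a \<Rightarrow> 'a list" where
  "pw h \<equiv> replicate m h"

lemma set_pw [simp]: "set (pw h) = {h}"
  using m_pos by simp

lemma gen_subgroup: "set xs \<subseteq> c \<Longrightarrow> subgroup (generate G (set xs)) G"
  using sub by (intro generate_is_subgroup) auto

lemma gen_finite: "set xs \<subseteq> c \<Longrightarrow> finite (generate G (set xs))"
  using finite_carrier generate_incl[of "set xs"] sub finite_subset by blast

lemma append_conj:
  assumes "set xs \<subseteq> c" "g \<in> c \<inter> generate G (set xs)" "h \<in> c \<inter> generate G (set xs)"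
  shows "heq (xs @ pw h) (xs @ pw g)"
proof -
  obtain a where "a \<in> generate G (set xs)" "g = cj a h"
    using transitive[OF gen_subgroup[OF assms(1)] assms(2,3)] by (auto simp: cj_def)
  then show ?thesis
    using replicate_conj_generate[OF assms(1), of a h m] assms pow_m by auto
qed

lemma split_off_power:
  assumes "set xs \<subseteq> c" "length xs > card c * m" "g \<in> c \<inter> generate G (set xs)"
  shows "\<exists>ys. set ys \<subseteq> c \<and> generate G (set ys) = generate G (set xs) \<and> heq xs (ys @ pw g)"
  by (rule long_tuple_splits_off_power[OF finite_c m_pos pow_m assms(1,2) HOL.refl assms(3)])
    (use assms transitive[OF gen_subgroup[OF assms(1)] assms(3)] in \<open>auto simp: cj_def\<close>)

text \<open>The orbits of those \<open>n\<close>-tuples whose entries generate \<open>K\<close>.\<close>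

definition generating_orbits :: "nat \<Rightarrow> 'a set \<Rightarrow> 'a list set set" where
  "generating_orbits n K = hurwitz_class G c ` {xs \<in> tuples c n. generate G (set xs) = K}"

lemma finite_generating_orbits: "finite (generating_orbits n K)"
  unfolding generating_orbits_def tuples_def
  by (rule finite_imageI, rule finite_subset[OF _ finite_lists_length_eq[OF finite_c, of n]]) auto

text \<open>In large length, appending \<open>i \<le> m\<close> copies of \<open>g\<close> is surjective onto the orbits generating \<open>K\<close>.
  The case \<open>i = 1\<close> makes the number of orbits non-increasing, the case \<open>i = m\<close> concerns the
  multiplication by \<open>g\<^sup>m\<close>.\<close>

lemma generating_orbits_subset_image:
  assumes "card c * m < n + i" "i \<le> m" "g \<in> c \<inter> K"
  shows "generating_orbits (n + i) K \<subseteq>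
    (\<lambda>A. concat_orbit G c A (hurwitz_class G c (replicate i g))) ` generating_orbits n K"
proof
  fix A assume "A \<in> generating_orbits (n + i) K"
  then obtain xs where xs: "A = hurwitz_class G c xs" "set xs \<subseteq> c" "length xs = n + i"
    "generate G (set xs) = K"
    by (auto simp: generating_orbits_def tuples_def)
  then obtain ys where ys: "set ys \<subseteq> c" "generate G (set ys) = K" "heq xs (ys @ pw g)"
    using split_off_power[of xs g] assms by auto
  \<comment> \<open>Only \<open>i\<close> of the \<open>m\<close> copies of \<open>g\<close> are detached.\<close>
  define zs where "zs = ys @ replicate (m - i) g"
  have zs: "zs @ replicate i g = ys @ pw g" "set zs \<subseteq> c"
    using ys assms by (auto simp: zs_def simp flip: replicate_add)
  have "generate G (set zs) = K"
    using generate_insert_mem[of ys g] ys assms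
    by (cases "m - i = 0") (auto simp: zs_def)
  moreover have "length zs = n"
    using heq_length[OF ys(3)] xs assms by (auto simp: zs_def)
  moreover have "A = concat_orbit G c (hurwitz_class G c zs) (hurwitz_class G c (replicate i g))"
    using xs zs ys assms concat_orbit_class[of zs "replicate i g"] hurwitz_class_eq_iff[of xs "ys @ pw g"]
    by (auto simp: set_replicate_conv_if)
  ultimately show "A \<in> (\<lambda>A. concat_orbit G c A (hurwitz_class G c (replicate i g))) ` generating_orbits n K"
    using zs by (auto simp: generating_orbits_def tuples_def)
qed

text \<open>Once the number of orbits is constant, a surjection between these finite sets is injective.\<close>

lemma eventually_inj_append_power:
  "\<forall>\<^sub>F n in sequentially. \<forall>g \<in> c \<inter> K.
     inj_on (\<lambda>A. concat_orbit G c A (hurwitz_class G c (pw g))) (generating_orbits n K)"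
proof (cases "c \<inter> K = {}")
  case False
  then obtain g where g: "g \<in> c \<inter> K" by blast
  have "card (generating_orbits (Suc n) K) \<le> card (generating_orbits n K)"
    if "card c * m \<le> n" for n
    using generating_orbits_subset_image[of n 1 g K] g that m_pos
    by (intro surj_card_le[OF finite_generating_orbits]) auto
  then obtain N where N: "card c * m \<le> N"
    "\<And>n. n \<ge> N \<Longrightarrow> card (generating_orbits n K) = card (generating_orbits N K)"
    using eventually_constant_of_antimono[of "card c * m" "\<lambda>n. card (generating_orbits n K)"] by auto
  show ?thesis
  proof (rule eventually_sequentiallyI[of N], rule ballI)
    fix n h assume n: "N \<le> n" and h: "h \<in> c \<inter> K"
    let ?f = "\<lambda>A. concat_orbit G c A (hurwitz_class G c (pw h))"
    have "card (generating_orbits n K) = card (generating_orbits (n + m) K)"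
      using N(2)[of n] N(2)[of "n + m"] n by simp
    also have "\<dots> \<le> card (?f ` generating_orbits n K)"
      using generating_orbits_subset_image[of n m h K] N(1) n m_pos h
      by (intro card_mono) (auto simp: finite_generating_orbits)
    finally show "inj_on ?f (generating_orbits n K)"
      using card_image_le[OF finite_generating_orbits, of ?f n K]
      by (intro eq_card_imp_inj_on finite_generating_orbits) simp
  qed
qed simp

text \<open>As there are finitely many subgroups, the bound on the length can be chosen uniformly.\<close>

lemma eventually_cancel_power:
  "\<forall>\<^sub>F n in sequentially. \<forall>xs ys g. xs \<in> tuples c n \<longrightarrow> ys \<in> tuples c n \<longrightarrow>
     generate G (set xs) = generate G (set ys) \<longrightarrow> g \<in> c \<inter> generate G (set xs) \<longrightarrow>
     heq (xs @ pw g) (ys @ pw g) \<longrightarrow> heq xs ys"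
proof -
  have "\<forall>\<^sub>F n in sequentially. \<forall>K\<in>Pow (carrier G). \<forall>g \<in> c \<inter> K.
     inj_on (\<lambda>A. concat_orbit G c A (hurwitz_class G c (pw g))) (generating_orbits n K)"
    by (rule eventually_ball_finite) (use finite_carrier eventually_inj_append_power in auto)
  then show ?thesis
  proof (rule eventually_mono, intro allI impI)
    fix n xs ys g
    let ?K = "generate G (set xs)"
    assume *: "\<forall>K\<in>Pow (carrier G). \<forall>g \<in> c \<inter> K.
       inj_on (\<lambda>A. concat_orbit G c A (hurwitz_class G c (pw g))) (generating_orbits n K)"
      and xy: "xs \<in> tuples c n" "ys \<in> tuples c n" "generate G (set xs) = generate G (set ys)"
      and g: "g \<in> c \<inter> ?K" and e: "heq (xs @ pw g) (ys @ pw g)"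
    have s: "set xs \<subseteq> c" "set ys \<subseteq> c" using xy by (auto simp: tuples_def)
    have "?K \<subseteq> carrier G" using s sub by (intro generate_incl) auto
    then have inj: "inj_on (\<lambda>A. concat_orbit G c A (hurwitz_class G c (pw g))) (generating_orbits n ?K)"
      using * g by auto
    have "hurwitz_class G c xs = hurwitz_class G c ys"
      by (rule inj_onD[OF inj])
        (use s g e xy in \<open>auto simp: concat_orbit_class hurwitz_class_eq_iff generating_orbits_def\<close>)
    then show "heq xs ys" using hurwitz_class_eq_iff s by blast
  qed
qed

end

section \<open>Bilinearity of the orbit algebra\<close>

lemma hurwitz_algebra_simps [simp]:
  "carrier (hurwitz_algebra G c) = {f. Poly_Mapping.keys f \<subseteq> (\<Union>n. hurwitz_orbits G c n)}"
  "\<one>\<^bsub>hurwitz_algebra G c\<^esub> = Poly_Mapping.single (hurwitz_class G c []) 1"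
  "\<zero>\<^bsub>hurwitz_algebra G c\<^esub> = 0"
  "f \<oplus>\<^bsub>hurwitz_algebra G c\<^esub> g = f + g"
  by (simp_all add: hurwitz_algebra_def)

context
  fixes G :: "('a, 'b) monoid_scheme" and c :: "'a set"
    and R :: "('a list set \<Rightarrow>\<^sub>0 'k::field) ring"
  defines "R \<equiv> hurwitz_algebra G c"
begin

lemma hurwitz_mult_expand:
  assumes "finite S" "Poly_Mapping.keys f \<subseteq> S" "finite Y" "Poly_Mapping.keys g \<subseteq> Y"
  shows "f \<otimes>\<^bsub>R\<^esub> g = (\<Sum>A\<in>S. \<Sum>B\<in>Y. Poly_Mapping.single (concat_orbit G c A B)
           (Poly_Mapping.lookup f A * Poly_Mapping.lookup g B))"
proof -
  have "f \<otimes>\<^bsub>R\<^esub> g = (\<Sum>A \<in> Poly_Mapping.keys f. \<Sum>B \<in> Poly_Mapping.keys g.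
                Poly_Mapping.single (concat_orbit G c A B)
                  (Poly_Mapping.lookup f A * Poly_Mapping.lookup g B))"
    by (simp add: R_def hurwitz_algebra_def)
  also have "\<dots> = (\<Sum>A \<in> S. \<Sum>B \<in> Poly_Mapping.keys g.
                Poly_Mapping.single (concat_orbit G c A B)
                  (Poly_Mapping.lookup f A * Poly_Mapping.lookup g B))"
    by (rule sum.mono_neutral_left) (use assms in \<open>auto simp: in_keys_iff\<close>)
  also have "\<dots> = (\<Sum>A\<in>S. \<Sum>B\<in>Y. Poly_Mapping.single (concat_orbit G c A B)
           (Poly_Mapping.lookup f A * Poly_Mapping.lookup g B))"
    by (intro sum.cong HOL.refl sum.mono_neutral_left) (use assms in \<open>auto simp: in_keys_iff\<close>)
  finally show ?thesis .
qed

lemma hurwitz_mult_add_left: "(f + g) \<otimes>\<^bsub>R\<^esub> u = f \<otimes>\<^bsub>R\<^esub> u + g \<otimes>\<^bsub>R\<^esub> u"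
proof -
  let ?S = "Poly_Mapping.keys f \<union> Poly_Mapping.keys g"
  show ?thesis
    using Poly_Mapping.keys_add[of f g]
    by (simp add: hurwitz_mult_expand[of ?S _ "Poly_Mapping.keys u"] lookup_add distrib_right
        single_add sum.distrib)
qed

lemma hurwitz_mult_add_right: "u \<otimes>\<^bsub>R\<^esub> (f + g) = u \<otimes>\<^bsub>R\<^esub> f + u \<otimes>\<^bsub>R\<^esub> g"
proof -
  let ?S = "Poly_Mapping.keys f \<union> Poly_Mapping.keys g"
  show ?thesis
    using Poly_Mapping.keys_add[of f g]
    by (simp add: hurwitz_mult_expand[of "Poly_Mapping.keys u" _ ?S] lookup_add distrib_left
        single_add sum.distrib)
qed

lemma hurwitz_mult_zero [simp]: "0 \<otimes>\<^bsub>R\<^esub> u = 0" "u \<otimes>\<^bsub>R\<^esub> 0 = 0"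
  by (simp_all add: R_def hurwitz_algebra_def)

lemma hurwitz_mult_uminus_left: "(- f) \<otimes>\<^bsub>R\<^esub> u = - (f \<otimes>\<^bsub>R\<^esub> u)"
  using hurwitz_mult_add_left[of f "- f" u] by (simp add: eq_neg_iff_add_eq_0 add.commute)

lemma hurwitz_mult_sum_left: "(\<Sum>i\<in>I. f i) \<otimes>\<^bsub>R\<^esub> u = (\<Sum>i\<in>I. f i \<otimes>\<^bsub>R\<^esub> u)"
  by (induction I rule: infinite_finite_induct) (simp_all add: hurwitz_mult_add_left)

lemma hurwitz_mult_sum_right: "u \<otimes>\<^bsub>R\<^esub> (\<Sum>i\<in>I. f i) = (\<Sum>i\<in>I. u \<otimes>\<^bsub>R\<^esub> f i)"
  by (induction I rule: infinite_finite_induct) (simp_all add: hurwitz_mult_add_right)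

lemma hurwitz_mult_single:
  "Poly_Mapping.single A a \<otimes>\<^bsub>R\<^esub> Poly_Mapping.single B b =
     Poly_Mapping.single (concat_orbit G c A B) (a * b)"
  by (simp add: hurwitz_mult_expand[of "{A}" _ "{B}"])

lemma abelian_monoid_hurwitz_algebra: "abelian_monoid R"
  by (rule abelian_monoidI)
    (use Poly_Mapping.keys_add in \<open>fastforce simp: R_def add_ac\<close>)+

lemma hurwitz_finsum_eq_sum:
  assumes "finite I" "\<And>i. i \<in> I \<Longrightarrow> f i \<in> carrier R"
  shows "finsum R f I = sum f I"
proof -
  interpret abelian_monoid R by (rule abelian_monoid_hurwitz_algebra)
  show ?thesis using assms
    by (induction I rule: finite_induct) (auto simp: finsum_insert Pi_def, simp_all add: R_def)
qed

end

text \<open>Every element is the combination of basis elements given by its coefficients.\<close>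

lemma sum_single_lookup: "f = (\<Sum>A\<in>Poly_Mapping.keys f. Poly_Mapping.single A (Poly_Mapping.lookup f A))"
  by (rule poly_mapping_eqI) (auto simp: lookup_sum lookup_single when_def in_keys_iff)

section \<open>The element U and multiplication by it\<close>

context non_splitting_class
begin

text \<open>The orbit of a tuple, as a basis element of the algebra.\<close>

abbreviation cl :: "'a list \<Rightarrow> 'a list set" where
  "cl \<equiv> hurwitz_class G c"

lemma cl_mem_orbits: "set xs \<subseteq> c \<Longrightarrow> cl xs \<in> hurwitz_orbits G c (length xs)"
  by (auto simp: hurwitz_orbits_eq tuples_def)

lemma hurwitz_gen_pow:
  assumes "h \<in> c"
  shows "hurwitz_gen G c h [^]\<^bsub>hurwitz_algebra G c\<^esub> (n::nat) =
    (Poly_Mapping.single (cl (replicate n h)) 1 :: 'a list set \<Rightarrow>\<^sub>0 'k::field)"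
proof (induction n)
  case 0
  then show ?case by simp
next
  case (Suc n)
  have "concat_orbit G c (cl (replicate n h)) (cl [h]) = cl (replicate (Suc n) h)"
    using concat_orbit_class[of "replicate n h" "[h]"] assms
    by (auto simp: set_replicate_conv_if replicate_append_same)
  then show ?case
    using Suc by (simp add: hurwitz_gen_def hurwitz_mult_single)
qed

text \<open>The element \<open>\<Sum>\<^sub>h r\<^sub>h\<^sup>m\<close>, written in the basis of orbits.\<close>

definition U :: "'a list set \<Rightarrow>\<^sub>0 'k::field" where
  "U = (\<Sum>h\<in>c. Poly_Mapping.single (cl (pw h)) 1)"

lemma hurwitz_U_eq:
  assumes "\<And>h. h \<in> c \<Longrightarrow> D * ord h = m"
  shows "hurwitz_U G c D = (U :: 'a list set \<Rightarrow>\<^sub>0 'k::field)"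
proof -
  have *: "hurwitz_gen G c h [^]\<^bsub>hurwitz_algebra G c\<^esub> (D * ord h) =
    (Poly_Mapping.single (cl (pw h)) 1 :: 'a list set \<Rightarrow>\<^sub>0 'k)" if "h \<in> c" for h
    using that by (simp only: assms hurwitz_gen_pow)
  have "hurwitz_U G c D = (\<Sum>h\<in>c. hurwitz_gen G c h [^]\<^bsub>hurwitz_algebra G c\<^esub> (D * ord h) :: 'a list set \<Rightarrow>\<^sub>0 'k)"
    unfolding hurwitz_U_def
    by (rule hurwitz_finsum_eq_sum)
      (use finite_c cl_mem_orbits[of "pw _"] in \<open>auto simp: *\<close>)
  then show ?thesis by (simp add: U_def *)
qed

lemma U_mem_part: "U \<in> hurwitz_part G c m"
proof -
  have "Poly_Mapping.keys U \<subseteq> (\<Union>h\<in>c. {cl (pw h)})"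
    unfolding U_def by (rule order.trans[OF Poly_Mapping.keys_sum]) simp
  then show ?thesis using cl_mem_orbits[of "pw _"] by (force simp: hurwitz_part_def)
qed

lemma mult_U:
  fixes f :: "'a list set \<Rightarrow>\<^sub>0 'k::field"
  shows "f \<otimes>\<^bsub>hurwitz_algebra G c\<^esub> U =
    (\<Sum>h\<in>c. \<Sum>A\<in>Poly_Mapping.keys f.
       Poly_Mapping.single (concat_orbit G c A (cl (pw h))) (Poly_Mapping.lookup f A))"
  by (simp add: U_def hurwitz_mult_sum_right hurwitz_mult_expand[OF finite_keys order.refl, where Y = "{_}"])

lemma U_mult:
  fixes f :: "'a list set \<Rightarrow>\<^sub>0 'k::field"
  shows "U \<otimes>\<^bsub>hurwitz_algebra G c\<^esub> f =
    (\<Sum>h\<in>c. \<Sum>A\<in>Poly_Mapping.keys f.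
       Poly_Mapping.single (concat_orbit G c (cl (pw h)) A) (Poly_Mapping.lookup f A))"
  by (simp add: U_def hurwitz_mult_sum_left hurwitz_mult_expand[OF _ _ finite_keys order.refl, where S = "{_}"])

lemma central_U: "central (hurwitz_algebra G c) (U :: 'a list set \<Rightarrow>\<^sub>0 'k::field)"
  unfolding central_def
proof (intro conjI ballI)
  show "U \<in> carrier (hurwitz_algebra G c)"
    using U_mem_part by (auto simp: hurwitz_part_def)
  fix f :: "'a list set \<Rightarrow>\<^sub>0 'k"
  assume f: "f \<in> carrier (hurwitz_algebra G c)"
  have "concat_orbit G c (cl (pw h)) A = concat_orbit G c A (cl (pw h))"
    if h: "h \<in> c" and A: "A \<in> Poly_Mapping.keys f" for h A
  proof -
    obtain xs where xs: "A = cl xs" "set xs \<subseteq> c"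
      using f A by (auto simp: hurwitz_orbits_eq tuples_def)
    then show ?thesis
      using h replicate_commute[OF h pow_m[OF h] xs(2)]
      by (simp add: concat_orbit_class hurwitz_class_eq_iff)
  qed
  then show "U \<otimes>\<^bsub>hurwitz_algebra G c\<^esub> f = f \<otimes>\<^bsub>hurwitz_algebra G c\<^esub> U"
    by (simp add: mult_U U_mult)
qed

lemma generate_append_pw:
  assumes "set xs \<subseteq> c" "h \<in> c"
  shows "generate G (set xs) \<subseteq> generate G (set (xs @ pw h))"
    and "h \<in> generate G (set (xs @ pw h))"
  by (intro mono_generate, simp) (auto intro: generate.incl)

lemma generate_heq_append:
  assumes "set xs \<subseteq> c" "g \<in> c \<inter> generate G (set xs)" "set zs \<subseteq> c" "h \<in> c"
    and "heq (zs @ pw h) (xs @ pw g)"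
  shows "generate G (set zs) \<subseteq> generate G (set xs)" "h \<in> generate G (set xs)"
  using heq_generate[OF assms(5)] generate_append_pw[OF assms(3,4)] generate_insert_mem[OF assms(1), of g] assms
  by auto

text \<open>Multiplication by \<open>U\<close> is surjective onto large degrees. For a tuple \<open>ys\<close>
  generating \<open>K\<close>, write \<open>ys \<sim> xs @ g\<^sup>m\<close> with \<open>xs\<close> generating \<open>K\<close>. The
  product \<open>xs \<cdot> U\<close> is \<open>|c \<inter> K|\<close> times the orbit of \<open>ys\<close> plus orbits of tuples generating strictly larger
  subgroups, which lie in the image by induction on \<open>|G| - |K|\<close>.\<close>

lemma long_part_subset_image:
  fixes f :: "'a list set \<Rightarrow>\<^sub>0 'k::field"
  assumes char: "\<And>K. subgroup K G \<Longrightarrow> c \<inter> K \<noteq> {} \<Longrightarrow> (of_nat (card (c \<inter> K)) :: 'k) \<noteq> 0"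
    and n: "card c * m < n + m" and f: "f \<in> hurwitz_part G c (n + m)"
  shows "f \<in> mult_image (hurwitz_algebra G c) U"
proof -
  let ?R = "hurwitz_algebra G c :: ('a list set \<Rightarrow>\<^sub>0 'k) ring"
  let ?I = "mult_image ?R U"
  have add: "f + g \<in> ?I" if "f \<in> ?I" "g \<in> ?I" for f g
    using that Poly_Mapping.keys_add unfolding mult_image_def
    by (fastforce simp: simp flip: hurwitz_mult_add_left)
  have diff: "f - g \<in> ?I" if fI: "f \<in> ?I" and gI: "g \<in> ?I" for f g
  proof -
    obtain g' where "g = g' \<otimes>\<^bsub>?R\<^esub> U" "g' \<in> carrier ?R" using gI by (auto simp: mult_image_def)
    then have "- g \<in> ?I"
      by (auto simp: mult_image_def simp flip: hurwitz_mult_uminus_left intro!: imageI)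
    then show ?thesis using add[OF fI] by fastforce
  qed
  have "0 \<in> ?I"
    unfolding mult_image_def by (rule image_eqI[of _ _ 0]) simp_all
  with add have sum: "sum F S \<in> ?I" if "\<And>i. i \<in> S \<Longrightarrow> F i \<in> ?I" for F and S :: "'z set"
    using that by (induction S rule: infinite_finite_induct) auto
  have single: "Poly_Mapping.single (cl ys) a \<in> ?I" if "ys \<in> tuples c (n + m)" for ys a
    using that
  proof (induction "card (carrier G) - card (generate G (set ys))" arbitrary: ys a rule: less_induct)
    case less
    let ?K = "generate G (set ys)"
    have ys: "set ys \<subseteq> c" "length ys = n + m" using less.prems by (auto simp: tuples_def)
    then obtain g where g: "g \<in> set ys" using m_pos by (cases ys) auto
    then have gK: "g \<in> c \<inter> ?K" using ys by (auto intro: generate.incl)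
    obtain xs where xs: "set xs \<subseteq> c" "generate G (set xs) = ?K" "heq ys (xs @ pw g)"
      using split_off_power[OF ys(1) _ gK] n ys by auto
    have lx: "length xs = n" using heq_length[OF xs(3)] ys by simp
    define d where "d = a / of_nat (card (c \<inter> ?K))"
    have d: "of_nat (card (c \<inter> ?K)) * d = a"
      using char[OF gen_subgroup[OF ys(1)]] gK by (auto simp: d_def)
    have in_K: "cl (xs @ pw h) = cl ys" if "h \<in> c \<inter> ?K" for h
      using append_conj[OF xs(1), of g h] xs that gK ys
      by (subst hurwitz_class_eq_iff) (auto intro: heq.trans heq.sym)
    \<comment> \<open>Outside \<open>K\<close>, the new entry \<open>h\<close> enlarges the generated subgroup.\<close>
    have not_K: "Poly_Mapping.single (cl (xs @ pw h)) d \<in> ?I" if h: "h \<in> c - ?K" for h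
    proof (rule less.hyps)
      let ?L = "generate G (set (xs @ pw h))"
      have s: "set (xs @ pw h) \<subseteq> c" using xs h by auto
      have "?K \<subset> ?L"
        using generate_append_pw[OF xs(1), of h] h xs(2) by blast
      then have "card ?K < card ?L"
        using psubset_card_mono[OF gen_finite[OF s]] by blast
      moreover have "card ?L \<le> card (carrier G)"
        by (intro card_mono finite_carrier generate_incl) (use s sub in blast)
      ultimately show "card (carrier G) - card ?L < card (carrier G) - card ?K"
        by simp
      show "xs @ pw h \<in> tuples c (n + m)" using s lx by (simp add: tuples_def)
    qed
    have "Poly_Mapping.single (cl xs) d \<otimes>\<^bsub>?R\<^esub> U = (\<Sum>h\<in>c. Poly_Mapping.single (cl (xs @ pw h)) d)"
      using xs by (simp add: U_def hurwitz_mult_sum_right hurwitz_mult_single concat_orbit_class)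
    also have "\<dots> = (\<Sum>h\<in>c \<inter> ?K. Poly_Mapping.single (cl (xs @ pw h)) d) +
        (\<Sum>h\<in>c - ?K. Poly_Mapping.single (cl (xs @ pw h)) d)"
      by (rule sum.Int_Diff[OF finite_c])
    also have "(\<Sum>h\<in>c \<inter> ?K. Poly_Mapping.single (cl (xs @ pw h)) d) = (\<Sum>h\<in>c \<inter> ?K. Poly_Mapping.single (cl ys) d)"
      by (rule sum.cong) (use in_K in auto)
    also have "\<dots> = Poly_Mapping.single (cl ys) a"
      by (rule poly_mapping_eqI) (simp add: lookup_sum lookup_single when_def d)
    finally have e: "Poly_Mapping.single (cl ys) a = Poly_Mapping.single (cl xs) d \<otimes>\<^bsub>?R\<^esub> U -
       (\<Sum>h\<in>c - ?K. Poly_Mapping.single (cl (xs @ pw h)) d)" by simp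
    have "Poly_Mapping.single (cl xs) d \<otimes>\<^bsub>?R\<^esub> U \<in> ?I"
      unfolding mult_image_def by (rule imageI) (use cl_mem_orbits[OF xs(1)] in auto)
    then show ?case unfolding e by (rule diff[OF _ sum[OF not_K]])
  qed
  have "(\<Sum>A\<in>Poly_Mapping.keys f. Poly_Mapping.single A (Poly_Mapping.lookup f A)) \<in> ?I"
    by (rule sum) (use f single in \<open>auto simp: hurwitz_part_def hurwitz_orbits_eq\<close>)
  then show ?thesis by (simp flip: sum_single_lookup)
qed

text \<open>Multiplication by \<open>U\<close> is injective in degrees where cancellation holds. Among the orbits occurring
  in \<open>f\<close>, choose that of a tuple \<open>xs\<close> generating a subgroup \<open>K\<close>
  of least order. By minimality and cancellation, the orbit of \<open>xs @ g\<^sup>m\<close> arises in \<open>f \<cdot> U\<close> from the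
  orbit of \<open>xs\<close> only, once for each \<open>h \<in> c \<inter> K\<close>.\<close>

lemma kernel_trivial:
  fixes f :: "'a list set \<Rightarrow>\<^sub>0 'k::field"
  assumes char: "\<And>K. subgroup K G \<Longrightarrow> c \<inter> K \<noteq> {} \<Longrightarrow> (of_nat (card (c \<inter> K)) :: 'k) \<noteq> 0"
    and n: "n > 0"
    and cancel: "\<And>xs ys g. \<lbrakk>xs \<in> tuples c n; ys \<in> tuples c n; generate G (set xs) = generate G (set ys);
       g \<in> c \<inter> generate G (set xs); heq (xs @ pw g) (ys @ pw g)\<rbrakk> \<Longrightarrow> heq xs ys"
    and f: "f \<in> hurwitz_part G c n" and fU: "f \<otimes>\<^bsub>hurwitz_algebra G c\<^esub> U = 0"
  shows "f = 0"
proof (rule ccontr)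
  assume "f \<noteq> 0"
  then obtain A where "A \<in> Poly_Mapping.keys f" by fastforce
  with f obtain xs0 where "xs0 \<in> tuples c n \<and> cl xs0 \<in> Poly_Mapping.keys f"
    by (auto simp: hurwitz_part_def hurwitz_orbits_eq)
  from ex_has_least_nat[of "\<lambda>xs. xs \<in> tuples c n \<and> cl xs \<in> Poly_Mapping.keys f" _
      "\<lambda>xs. card (generate G (set xs))", OF this]
  obtain xs where xs: "xs \<in> tuples c n" "cl xs \<in> Poly_Mapping.keys f"
    and least: "\<And>ys. ys \<in> tuples c n \<Longrightarrow> cl ys \<in> Poly_Mapping.keys f \<Longrightarrow>
      card (generate G (set xs)) \<le> card (generate G (set ys))" by blast
  let ?K = "generate G (set xs)"
  have xc: "set xs \<subseteq> c" "length xs = n" using xs by (auto simp: tuples_def)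
  then obtain g where g: "g \<in> set xs" using n by (cases xs) auto
  then have gK: "g \<in> c \<inter> ?K" using xc by (auto intro: generate.incl)
  let ?C = "cl (xs @ pw g)"
  have eq_C: "concat_orbit G c A (cl (pw h)) = ?C \<longleftrightarrow> h \<in> ?K \<and> A = cl xs"
    if h: "h \<in> c" and A: "A \<in> Poly_Mapping.keys f" for h A
  proof -
    obtain zs where zs: "A = cl zs" "zs \<in> tuples c n" "set zs \<subseteq> c"
      using f A by (auto simp: hurwitz_part_def hurwitz_orbits_eq tuples_def)
    have e: "concat_orbit G c A (cl (pw h)) = ?C \<longleftrightarrow> heq (zs @ pw h) (xs @ pw g)"
      using zs h xc gK by (simp add: concat_orbit_class hurwitz_class_eq_iff)
    show ?thesis unfolding e
    proof
      assume *: "heq (zs @ pw h) (xs @ pw g)"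
      have "generate G (set zs) \<subseteq> ?K" and hK: "h \<in> ?K"
        using generate_heq_append[OF xc(1) gK zs(3) h *] by auto
      then have gen: "?K = generate G (set zs)"
        using least[OF zs(2)] A zs(1) card_subset_eq[OF gen_finite[OF xc(1)]] card_mono[OF gen_finite[OF xc(1)]]
        by (metis order.antisym)
      have "heq (zs @ pw g) (zs @ pw h)"
        using append_conj[OF zs(3)] gen gK h hK by auto
      with * have "heq (xs @ pw g) (zs @ pw g)" by (blast intro: heq.trans heq.sym)
      then have "heq xs zs" using cancel[OF xs(1) zs(2) gen gK] by blast
      then show "h \<in> ?K \<and> A = cl xs" using hK zs xc hurwitz_class_eq_iff by blast
    next
      assume *: "h \<in> ?K \<and> A = cl xs"
      then have "heq zs xs" using zs xc hurwitz_class_eq_iff by blast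
      then have "heq (zs @ pw h) (xs @ pw h)" by (intro heq_append) auto
      also have "heq \<dots> (xs @ pw g)" using append_conj[OF xc(1) gK] * h by auto
      finally show "heq (zs @ pw h) (xs @ pw g)" .
    qed
  qed
  have "Poly_Mapping.lookup (f \<otimes>\<^bsub>hurwitz_algebra G c\<^esub> U) ?C =
    (\<Sum>h\<in>c. \<Sum>A\<in>Poly_Mapping.keys f. if h \<in> ?K \<and> A = cl xs then Poly_Mapping.lookup f A else 0)"
    by (simp add: mult_U lookup_sum lookup_single when_def eq_C cong: sum.cong)
  also have "\<dots> = (\<Sum>h\<in>c. if h \<in> ?K then Poly_Mapping.lookup f (cl xs) else 0)"
    by (intro sum.cong) (use xs(2) in \<open>auto simp: sum.delta\<close>)
  also have "\<dots> = of_nat (card (c \<inter> ?K)) * Poly_Mapping.lookup f (cl xs)"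
    using finite_c by (simp add: sum.inter_restrict[symmetric])
  finally show False
    using fU char[OF gen_subgroup[OF xc(1)]] gK xs(2) by (auto simp: in_keys_iff)
qed

end

section \<open>Degrees of kernel and cokernel\<close>

lemma graded_degree_finite:
  assumes "\<And>n. N \<le> n \<Longrightarrow> M n = {z}"
  shows "graded_degree z M \<noteq> \<infinity>"
proof -
  have "graded_degree z M \<le> ereal (real N)"
    unfolding graded_degree_def by (rule SUP_least) (use assms in \<open>force simp: not_le[symmetric]\<close>)
  then show ?thesis by auto
qed

lemma (in non_splitting_class) kernel_degree_U:
  assumes char: "\<And>K. subgroup K G \<Longrightarrow> c \<inter> K \<noteq> {} \<Longrightarrow> (of_nat (card (c \<inter> K)) :: 'k::field) \<noteq> 0"
  shows "kernel_degree (hurwitz_algebra G c :: ('a list set \<Rightarrow>\<^sub>0 'k) ring) (hurwitz_part G c) U \<noteq> \<infinity>"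
proof -
  obtain N where N: "\<And>n xs ys g. \<lbrakk>N \<le> n; xs \<in> tuples c n; ys \<in> tuples c n;
      generate G (set xs) = generate G (set ys); g \<in> c \<inter> generate G (set xs);
      heq (xs @ pw g) (ys @ pw g)\<rbrakk> \<Longrightarrow> heq xs ys"
    using eventually_cancel_power unfolding eventually_sequentially by blast
  have "mult_kernel (hurwitz_algebra G c :: ('a list set \<Rightarrow>\<^sub>0 'k) ring) U \<inter> hurwitz_part G c n = {0}"
    if n: "Suc N \<le> n" for n
  proof
    show "mult_kernel (hurwitz_algebra G c :: ('a list set \<Rightarrow>\<^sub>0 'k) ring) U \<inter> hurwitz_part G c n \<subseteq> {0}"
      using kernel_trivial[OF char, of n] N[of n] n
      by (auto simp: mult_kernel_def a_kernel_def')
  qed (simp add: mult_kernel_def a_kernel_def' hurwitz_part_def)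
  then show ?thesis
    unfolding kernel_degree_def by (intro graded_degree_finite[of "Suc N"]) simp_all
qed

lemma (in non_splitting_class) cokernel_degree_U:
  assumes char: "\<And>K. subgroup K G \<Longrightarrow> c \<inter> K \<noteq> {} \<Longrightarrow> (of_nat (card (c \<inter> K)) :: 'k::field) \<noteq> 0"
  shows "cokernel_degree (hurwitz_algebra G c :: ('a list set \<Rightarrow>\<^sub>0 'k) ring) (hurwitz_part G c) U \<noteq> \<infinity>"
proof -
  let ?R = "hurwitz_algebra G c :: ('a list set \<Rightarrow>\<^sub>0 'k) ring"
  let ?I = "mult_image ?R U"
  have one: "\<one>\<^bsub>mult_cokernel ?R U\<^esub> = ?I"
    by (simp add: mult_cokernel_def A_FactGroup_def FactGroup_def)
  have coset: "?I +>\<^bsub>?R\<^esub> x = ?I" if x: "x \<in> ?I" for x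
  proof -
    obtain y where y: "y \<in> carrier ?R" "x = y \<otimes>\<^bsub>?R\<^esub> U" using x by (auto simp: mult_image_def)
    have "?I +>\<^bsub>?R\<^esub> x = (\<lambda>z. (z + y) \<otimes>\<^bsub>?R\<^esub> U) ` carrier ?R"
      unfolding a_r_coset_def' mult_image_def by (auto simp: y hurwitz_mult_add_left)
    also have "\<dots> = (\<lambda>z. z \<otimes>\<^bsub>?R\<^esub> U) ` ((\<lambda>z. z + y) ` carrier ?R)"
      by (simp add: image_image)
    also have "(\<lambda>z. z + y) ` carrier ?R = carrier ?R"
    proof
      show "(\<lambda>z. z + y) ` carrier ?R \<subseteq> carrier ?R"
        using y(1) Poly_Mapping.keys_add by fastforce
      show "carrier ?R \<subseteq> (\<lambda>z. z + y) ` carrier ?R"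
      proof
        fix z assume "z \<in> carrier ?R"
        then show "z \<in> (\<lambda>z. z + y) ` carrier ?R"
          using y(1) Poly_Mapping.keys_add[of z "- y"] by (intro image_eqI[of _ _ "z - y"]) auto
      qed
    qed
    finally show ?thesis by (simp add: mult_image_def)
  qed
  have "(\<lambda>x. ?I +>\<^bsub>?R\<^esub> x) ` hurwitz_part G c n = {?I}" if "card c * m + m + 1 \<le> n" for n
  proof -
    have "hurwitz_part G c n \<subseteq> ?I"
      using long_part_subset_image[OF char, of "n - m"] that by auto
    moreover have "0 \<in> hurwitz_part G c n" by (simp add: hurwitz_part_def)
    ultimately show ?thesis using coset by blast
  qed
  then show ?thesis
    unfolding cokernel_degree_def one by (rule graded_degree_finite)
qed

section \<open>Conjugacy classes\<close>

lemma (in group) conjugacy_class_cases: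
  assumes "conjugacy_class G c"
  obtains x where "x \<in> carrier G" "c = {g \<otimes> x \<otimes> inv g | g. g \<in> carrier G}"
  using assms by (auto simp: conjugacy_class_def orbits_def orbit_def)

lemma (in group) conjugacy_class_subgroup_transitive:
  assumes "subgroup K G" "conjugacy_class (G\<lparr>carrier := K\<rparr>) C" "g \<in> C" "h \<in> C"
  shows "\<exists>a\<in>K. g = a \<otimes> h \<otimes> inv a"
proof -
  interpret K: subgroup K G by fact
  interpret GK: group "G\<lparr>carrier := K\<rparr>" by (rule subgroup_imp_group[OF assms(1)])
  obtain x where x: "x \<in> K" "C = {a \<otimes> x \<otimes> inv\<^bsub>G\<lparr>carrier := K\<rparr>\<^esub> a | a. a \<in> K}"
    using GK.conjugacy_class_cases[OF assms(2)] by auto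
  then obtain a b where "a \<in> K" "b \<in> K" "g = a \<otimes> x \<otimes> inv\<^bsub>G\<lparr>carrier := K\<rparr>\<^esub> a"
    "h = b \<otimes> x \<otimes> inv\<^bsub>G\<lparr>carrier := K\<rparr>\<^esub> b"
    using assms(3,4) by blast
  then have ab: "a \<in> K" "b \<in> K" "g = a \<otimes> x \<otimes> inv a" "h = b \<otimes> x \<otimes> inv b"
    by (simp_all add: m_inv_consistent[OF assms(1)])
  have cancel: "inv b \<otimes> (b \<otimes> y) = y" if "y \<in> carrier G" for y
    using ab that by (simp flip: m_assoc)
  have "g = (a \<otimes> inv b) \<otimes> h \<otimes> inv (a \<otimes> inv b)"
    using ab x(1) by (simp add: m_assoc inv_mult_group cancel)
  then show ?thesis using ab by blast
qed

theorem propositionA3p1: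
  fixes G :: "('a, 'b) monoid_scheme" and c :: "'a set" and D :: nat
    and R :: "('a list set \<Rightarrow>\<^sub>0 'k::field) ring" and U :: "'a list set \<Rightarrow>\<^sub>0 'k"
  assumes "group G" and "finite (carrier G)"
    and "conjugacy_class G c"
    and "non_splitting G c"
    and "D > 0"
    and "\<And>K. subgroup K G \<Longrightarrow> c \<inter> K \<noteq> {} \<Longrightarrow> (of_nat (card (c \<inter> K)) :: 'k) \<noteq> 0"
    and "R = hurwitz_algebra G c"
    and "U = hurwitz_U G c D"
  shows "homogeneous (hurwitz_part G c) U \<and>
    non_invertible R (hurwitz_part G c) U \<and>
    central R U \<and>
    kernel_degree R (hurwitz_part G c) U \<noteq> \<infinity> \<and>
    cokernel_degree R (hurwitz_part G c) U \<noteq> \<infinity>"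
proof -
  interpret group G by fact
  obtain x where x: "x \<in> carrier G" "c = {g \<otimes>\<^bsub>G\<^esub> x \<otimes>\<^bsub>G\<^esub> inv\<^bsub>G\<^esub> g | g. g \<in> carrier G}"
    using conjugacy_class_cases[OF assms(3)] .
  interpret C: conjugation_invariant_subset G c
  proof
    show "c \<subseteq> carrier G" using x by auto
    fix g y assume g: "g \<in> carrier G" and "y \<in> c"
    then obtain a where a: "a \<in> carrier G" "y = a \<otimes>\<^bsub>G\<^esub> x \<otimes>\<^bsub>G\<^esub> inv\<^bsub>G\<^esub> a" using x by blast
    then have "g \<otimes>\<^bsub>G\<^esub> y \<otimes>\<^bsub>G\<^esub> inv\<^bsub>G\<^esub> g = (g \<otimes>\<^bsub>G\<^esub> a) \<otimes>\<^bsub>G\<^esub> x \<otimes>\<^bsub>G\<^esub> inv\<^bsub>G\<^esub> (g \<otimes>\<^bsub>G\<^esub> a)"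
      using g x(1) by (simp add: m_assoc inv_mult_group)
    then show "g \<otimes>\<^bsub>G\<^esub> y \<otimes>\<^bsub>G\<^esub> inv\<^bsub>G\<^esub> g \<in> c" using x g a by blast
  qed
  \<comment> \<open>Conjugate elements have the same order, so all summands of \<open>U\<close> have the same degree \<open>m\<close>.\<close>
  define m where "m = D * ord x"
  have ord_c: "ord h = ord x" if "h \<in> c" for h
  proof -
    from that obtain a where a: "a \<in> carrier G" "h = C.cj a x"
      unfolding x(2) C.cj_def by blast
    have "C.cj a y = \<one>\<^bsub>G\<^esub> \<longleftrightarrow> y = \<one>\<^bsub>G\<^esub>" if "y \<in> carrier G" for y
      using inj_on_eq_iff[OF C.inj_on_cj[OF a(1)] that one_closed] a(1) by simp
    then have "h [^]\<^bsub>G\<^esub> n = \<one>\<^bsub>G\<^esub> \<longleftrightarrow> x [^]\<^bsub>G\<^esub> n = \<one>\<^bsub>G\<^esub>" for n :: nat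
      using a x(1) by simp
    then show ?thesis using a x(1) ord_unique[of h "ord x"] pow_eq_id[of x] by simp
  qed
  interpret N: non_splitting_class G c m
  proof
    show "finite (carrier G)" by fact
    show "m > 0" using assms(5) ord_ge_1[OF assms(2) x(1)] by (simp add: m_def)
    show "h [^]\<^bsub>G\<^esub> m = \<one>\<^bsub>G\<^esub>" if "h \<in> c" for h
      using ord_c[OF that] that by (simp add: m_def pow_eq_id)
    show "\<exists>a\<in>K. g = a \<otimes>\<^bsub>G\<^esub> h \<otimes>\<^bsub>G\<^esub> inv\<^bsub>G\<^esub> a"
      if K: "subgroup K G" and gh: "g \<in> c \<inter> K" "h \<in> c \<inter> K" for K g h
      using conjugacy_class_subgroup_transitive[OF K _ gh] assms(4) K gh
      unfolding non_splitting_def by blast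
  qed
  have U: "U = N.U"
    unfolding assms(8) by (rule N.hurwitz_U_eq) (simp add: ord_c m_def)
  show ?thesis
    unfolding U assms(7)
    using N.U_mem_part N.m_pos N.central_U N.kernel_degree_U[OF assms(6)] N.cokernel_degree_U[OF assms(6)]
    unfolding homogeneous_def non_invertible_def by blast
qed

end
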